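(* Let $N\ge 1$ be an integer and consider a homogeneous $3$-user $2\times 1$ broadcast channel with coherence time $N$ and offsets $n_{\delta,1}=0$ and $n_{\delta,2},n_{\delta,3}\in\{0,1,\dots,N-1\}$. Put $$s_0=\min(n_{\delta,2},n_{\delta,3}),\qquad s_1=\max(n_{\delta,2},n_{\delta,3})-\min(n_{\delta,2},n_{\delta,3}),\qquad s_2=N-\max(n_{\delta,2},n_{\delta,3}).$$ If $$\sum_{i=0}^{2}s_i\le 4\min(s_0,s_1,s_2),$$ then the broadcast channel is BIA-feasible.
   Context: Channel model. A homogeneous $3$-user $2\times1$ broadcast channel (BC) has one transmitter with two antennas $j\in\{1,2\}$ and three single-antenna users $i\in\{1,2,3\}$. Time slots are $n=0,1,2,\dots$. Let $h_{ij}(n)\in\mathbb{C}$ be the coefficient from antenna $j$ to user $i$ at time $n$ and $H_i(n)=[h_{i1}(n),h_{i2}(n)]^T$. All users have the same coherence time $N$, and user $i$ has offset $n_{\delta,i}\in\{0,\dots,N-1\}$: slots $n,n'$ lie in the same coherence block of user $i$ iff $\lfloor (n-n_{\delta,i})/N\rfloor=\lfloor (n'-n_{\delta,i})/N\rfloor$, and $H_i(n)$ depends only on the coherence block of user $i$ containing $n$. The coefficients are otherwise arbitrary and generic: all $h_{ij}(n)$ are nonzero and, for each user, the vectors $H_i$ in two different coherence blocks of that user are linearly independent. The transmitter knows $N$ and the offsets but not the coefficient values (no CSIT). BIA-feasible 4-symbol block. A 4-symbol channel block is a choice of four time slots $n_1<n_2<n_3<n_4$ (not necessarily consecutive). Put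 $H_{ij}=\mathrm{diag}(h_{ij}(n_1),h_{ij}(n_2),h_{ij}(n_3),h_{ij}(n_4))$. The block is BIA-feasible (BIA = blind interference alignment) if there are vectors $\mathbf v_1,\mathbf v_2,\mathbf v_3,\mathbf u_1,\mathbf u_2,\mathbf u_3\in\mathbb{C}^{4}$, chosen independently of the coefficient values, such that for every generic choice of coefficients: (alignment) for all $i$ and all $k\ne i$ in $\{1,2,3\}$, $H_{i1}\mathbf v_k=c\,H_{i2}\mathbf u_k$ for some nonzero scalar $c$; and (decodability) for each $i$, the four vectors $H_{i1}\mathbf v_i$, $H_{i2}\mathbf u_i$ and $H_{i1}\mathbf v_k$ ($k\neq i$) are linearly independent. (Then six symbols are delivered in four channel uses, i.e. $\tfrac32$ degrees of freedom.) BIA-feasible BC. The BC is BIA-feasible if the set of time slots $\{0,1,2,\dots\}$, after discarding finitely many slots, can be partitioned into BIA-feasible 4-symbol channel blocks. *)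

theory Defs
  imports "HOL-Analysis.Analysis"
begin

text \<open>Users are indexed by the type \<open>3\<close>, antennas by \<open>2\<close> and the positions inside a
  4-symbol block by \<open>4\<close>. These are types of residues, so that \<open>3 = 0\<close>, \<open>2 = 0\<close> and \<open>4 = 0\<close>
  hold in them respectively; no order on these types is used.\<close>

text \<open>A channel \<open>h\<close> assigns to user \<open>i\<close> and slot \<open>n\<close> the vector \<open>h i n\<close> with the components
  \<open>h i n $ 1\<close> and \<open>h i n $ 2\<close>.\<close>

type_synonym channel = "3 \<Rightarrow> nat \<Rightarrow> complex ^ 2"

text \<open>Linear independence of a finite family: a repeated vector makes the family dependent.\<close>

definition lin_indep_list :: "(complex ^ 'm) list \<Rightarrow> bool" where
  "lin_indep_list xs \<longleftrightarrow> distinct xs \<and> vec.independent (set xs)"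

text \<open>On \<open>int\<close>, \<open>div\<close> by a positive number rounds towards minus infinity, so the slots before
  the offset form the (incomplete) coherence block number \<open>-1\<close>.\<close>

definition coherence_block :: "nat \<Rightarrow> (3 \<Rightarrow> nat) \<Rightarrow> 3 \<Rightarrow> nat \<Rightarrow> int" where
  "coherence_block N offset i n = (int n - int (offset i)) div int N"

definition generic_channel :: "nat \<Rightarrow> (3 \<Rightarrow> nat) \<Rightarrow> channel \<Rightarrow> bool" where
  "generic_channel N offset h \<longleftrightarrow>
     (\<forall>i n n'. coherence_block N offset i n = coherence_block N offset i n' \<longrightarrow> h i n = h i n') \<and>
     (\<forall>i n j. h i n $ j \<noteq> 0) \<and>
     (\<forall>i n n'. coherence_block N offset i n \<noteq> coherence_block N offset i n' \<longrightarrow>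
        lin_indep_list [h i n, h i n'])"

definition channel_matrix :: "channel \<Rightarrow> nat ^ 4 \<Rightarrow> 3 \<Rightarrow> 2 \<Rightarrow> complex ^ 4 ^ 4" where
  "channel_matrix h n i j = (\<chi> r c. if r = c then h i (n $ r) $ j else 0)"

definition aligned :: "channel \<Rightarrow> nat ^ 4 \<Rightarrow> (3 \<Rightarrow> complex ^ 4) \<Rightarrow> (3 \<Rightarrow> complex ^ 4) \<Rightarrow> bool" where
  "aligned h n v u \<longleftrightarrow>
     (\<forall>i k. k \<noteq> i \<longrightarrow>
        (\<exists>c. c \<noteq> 0 \<and> channel_matrix h n i 1 *v v k = c *s (channel_matrix h n i 2 *v u k)))"

definition decodable :: "channel \<Rightarrow> nat ^ 4 \<Rightarrow> (3 \<Rightarrow> complex ^ 4) \<Rightarrow> (3 \<Rightarrow> complex ^ 4) \<Rightarrow> bool" where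
  "decodable h n v u \<longleftrightarrow>
     (\<forall>i k l. distinct [i, k, l] \<longrightarrow>
        lin_indep_list [channel_matrix h n i 1 *v v i, channel_matrix h n i 2 *v u i,
                        channel_matrix h n i 1 *v v k, channel_matrix h n i 1 *v v l])"

text \<open>The vectors \<open>v\<close>, \<open>u\<close> are chosen before \<open>h\<close>: the transmitter knows \<open>N\<close> and the offsets
  but not the coefficients.\<close>

definition bia_feasible_block :: "nat \<Rightarrow> (3 \<Rightarrow> nat) \<Rightarrow> nat ^ 4 \<Rightarrow> bool" where
  "bia_feasible_block N offset n \<longleftrightarrow>
     n $ 1 < n $ 2 \<and> n $ 2 < n $ 3 \<and> n $ 3 < n $ 4 \<and>
     (\<exists>v u. \<forall>h. generic_channel N offset h \<longrightarrow> aligned h n v u \<and> decodable h n v u)"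

definition bia_feasible_bc :: "nat \<Rightarrow> (3 \<Rightarrow> nat) \<Rightarrow> bool" where
  "bia_feasible_bc N offset \<longleftrightarrow>
     (\<exists>F P. finite F \<and> partition_on (UNIV - F) P \<and>
        (\<forall>B\<in>P. \<exists>n. bia_feasible_block N offset n \<and> B = {n $ 1, n $ 2, n $ 3, n $ 4}))"

end

theory Submission
  imports Defs
begin

text \<open>The offsets cut the time line into segments of lengths \<open>s 0, s 1, s 2, s 0, \<dots>\<close>, and at each
  boundary exactly one user, in cyclic order, changes its coherence block. Four slots lying in four
  consecutive segments form a feasible block: the user \<open>k\<close> that changes between the \<open>r\<close>-th and the
  next slot gets \<open>v k = u k = e\<^sub>r + e\<^sub>r\<^sub>+\<^sub>1\<close>. So it suffices to choose the numbers \<open>x m\<close> of blocks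
  that start in segment \<open>m\<close> such that \<open>x m + x (m - 1) + x (m - 2) + x (m - 3)\<close> is the length of
  segment \<open>m\<close>. If \<open>f\<close> has period 4 and sums to \<open>N\<close> over a period, then \<open>x m = s (m mod 3) - f m\<close>
  does this, because three consecutive segments have total length \<open>N\<close>. The choice
  \<open>f m = \<lfloor>(N + m mod 4) / 4\<rfloor>\<close> is at most \<open>\<lceil>N / 4\<rceil>\<close>, and the hypothesis gives \<open>x m \<ge> 0\<close>.\<close>

section \<open>Linear independence criteria\<close>

lemma lin_indep_listI4:
  fixes w x y z :: "complex ^ 'm"
  assumes *: "\<And>a b c d. a *s w + b *s x + c *s y + d *s z = 0 \<Longrightarrow> a = 0 \<and> b = 0 \<and> c = 0 \<and> d = 0"
  shows "lin_indep_list [w, x, y, z]"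
proof -
  have "distinct [w, x, y, z]"
    \<comment> \<open>Coefficients \<open>1\<close> and \<open>-1\<close> on a coinciding pair would
      give a nontrivial relation. Distinctness also lets the sum over the set unfold into four terms
      below.\<close>
    using *[of 1 "-1" 0 0] *[of 1 0 "-1" 0] *[of 1 0 0 "-1"]
      *[of 0 1 "-1" 0] *[of 0 1 0 "-1"] *[of 0 0 1 "-1"]
    by auto
  moreover have fin: "finite {w, x, y, z}"
    by simp
  have "vec.independent {w, x, y, z}"
    unfolding vec.dependent_finite[OF fin]
  proof
    assume "\<exists>f. (\<exists>v\<in>{w, x, y, z}. f v \<noteq> 0) \<and> (\<Sum>v\<in>{w, x, y, z}. f v *s v) = 0"
    then obtain f where f: "\<exists>v\<in>{w, x, y, z}. f v \<noteq> 0" "(\<Sum>v\<in>{w, x, y, z}. f v *s v) = 0"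
      by blast
    have "f w *s w + f x *s x + f y *s y + f z *s z = 0"
      using f(2) \<open>distinct [w, x, y, z]\<close> by (simp add: add.assoc)
    from *[OF this] f(1) show False
      by auto
  qed
  ultimately show ?thesis
    by (simp add: lin_indep_list_def)
qed

text \<open>Elimination shows that both coefficients are annihilated by the determinant of the
  matrix with rows \<open>p\<close> and \<open>q\<close>; if that determinant vanished,
  \<open>p\<close> would be a multiple of \<open>q\<close>. This turns genericity, a statement about
  rows, into the trivial kernel that decoding needs.\<close>

lemma lin_indep_list2_coeffs_zero:
  fixes p q :: "complex ^ 2"
  assumes "lin_indep_list [p, q]" "q $ 1 \<noteq> 0"
    and "a * p $ 1 + b * p $ 2 = 0" "a * q $ 1 + b * q $ 2 = 0"
  shows "a = 0 \<and> b = 0"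
proof (rule ccontr)
  assume ab: "\<not> (a = 0 \<and> b = 0)"
  have "b * (p $ 1 * q $ 2 - p $ 2 * q $ 1) = 0" "a * (p $ 1 * q $ 2 - p $ 2 * q $ 1) = 0"
    using assms(3,4) by algebra+
  with ab have det: "p $ 1 * q $ 2 = p $ 2 * q $ 1"
    by auto
  have "p = (p $ 1 / q $ 1) *s q"
    using \<open>q $ 1 \<noteq> 0\<close> det by (simp add: vec_eq_iff forall_2 field_simps)
  then have "p \<in> vec.span {q}"
    by (metis vec.span_base vec.span_scale singletonI)
  moreover have "p \<noteq> q" "vec.independent {p, q}"
    using assms(1) by (auto simp: lin_indep_list_def)
  ultimately show False
    by (simp add: vec.independent_insert)
qed

section \<open>Feasibility of four slots in consecutive segments\<close>

lemma channel_matrix_mult_nth: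
  "(channel_matrix h n i j *v x) $ r = h i (n $ r) $ j * x $ r"
  by (simp add: channel_matrix_def matrix_vector_mult_def if_distrib[of "\<lambda>t. t * _"] cong: if_cong)

lemma three_cases:
  fixes a b c i :: 3
  assumes "distinct [a, b, c]"
  shows "i = a \<or> i = b \<or> i = c"
proof -
  have "{a, b, c} = UNIV"
    by (rule card_subset_eq) (use assms in auto)
  then show ?thesis
    by blast
qed

text \<open>The channel of user \<open>i\<close> is constant on the two-slot support of
  \<open>v k\<close> for every \<open>k \<noteq> i\<close>, so interference from both antennas is
  parallel. On the support of \<open>v i\<close> it takes two independent values, which separate the
  two desired symbols.\<close>

lemma bia_feasible_block_chain:
  fixes a b c :: 3 and n :: "nat ^ 4"
  assumes users: "distinct [a, b, c]"
    and less: "n $ 1 < n $ 2" "n $ 2 < n $ 3" "n $ 3 < n $ 4"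
    and a: "K a (n $ 1) \<noteq> K a (n $ 2)" "K a (n $ 2) = K a (n $ 3)" "K a (n $ 3) = K a (n $ 4)"
    and b: "K b (n $ 1) = K b (n $ 2)" "K b (n $ 2) \<noteq> K b (n $ 3)" "K b (n $ 3) = K b (n $ 4)"
    and c: "K c (n $ 1) = K c (n $ 2)" "K c (n $ 2) = K c (n $ 3)" "K c (n $ 3) \<noteq> K c (n $ 4)"
    and K: "K = coherence_block N offset"
  shows "bia_feasible_block N offset n"
proof -
  define v :: "3 \<Rightarrow> complex ^ 4" where
    "v = (\<lambda>k. if k = a then axis 1 1 + axis 2 1 else if k = b then axis 2 1 + axis 3 1
              else axis 3 1 + axis 4 1)"
  have [simp]: "a \<noteq> b" "a \<noteq> c" "b \<noteq> c" "b \<noteq> a" "c \<noteq> a" "c \<noteq> b"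
    using users by auto
  have va: "v a $ 1 = 1" "v a $ 2 = 1" "v a $ 3 = 0" "v a $ 4 = 0"
    and vb: "v b $ 1 = 0" "v b $ 2 = 1" "v b $ 3 = 1" "v b $ 4 = 0"
    and vc: "v c $ 1 = 0" "v c $ 2 = 0" "v c $ 3 = 1" "v c $ 4 = 1"
    by (auto simp: v_def axis_def)
  note v = va vb vc
  have "aligned h n v v \<and> decodable h n v v" if "generic_channel N offset h" for h
  proof
    have same: "h i p = h i q" if "K i p = K i q" for i p q
      using \<open>generic_channel N offset h\<close> that unfolding generic_channel_def K by blast
    have nz: "h i p $ j \<noteq> 0" for i p j
      using \<open>generic_channel N offset h\<close> unfolding generic_channel_def by blast
    have zero: "\<alpha> = 0 \<and> \<beta> = 0" if "K i p \<noteq> K i q"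
      "\<alpha> * h i p $ 1 + \<beta> * h i p $ 2 = 0" "\<alpha> * h i q $ 1 + \<beta> * h i q $ 2 = 0" for i p q \<alpha> \<beta>
    proof -
      have "lin_indep_list [h i p, h i q]"
        using \<open>generic_channel N offset h\<close> that(1) unfolding generic_channel_def K by blast
      then show ?thesis
        using nz that(2,3) by (rule lin_indep_list2_coeffs_zero)
    qed
    note eqs = same[OF a(2)] same[OF a(3)] same[OF b(1)] same[OF b(3)] same[OF c(1)] same[OF c(2)]
    show "aligned h n v v"
      unfolding aligned_def
    proof (intro allI impI)
      fix i k :: 3
      assume "k \<noteq> i"
      \<comment> \<open>The alignment scalar is the ratio of the two coefficients that user
        \<open>i\<close> sees on the whole support of \<open>v k\<close>; \<open>m\<close> is any
        slot representing that common value.\<close>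
      have *: "\<exists>t. t \<noteq> 0 \<and> channel_matrix h n i 1 *v v k = t *s (channel_matrix h n i 2 *v v k)"
        if "\<And>r. v k $ r \<noteq> 0 \<Longrightarrow> h i (n $ r) = h i m" for m
      proof (intro exI conjI)
        show "h i m $ 1 / h i m $ 2 \<noteq> 0"
          using nz by simp
        show "channel_matrix h n i 1 *v v k = (h i m $ 1 / h i m $ 2) *s (channel_matrix h n i 2 *v v k)"
          unfolding vec_eq_iff
        proof
          fix r
          show "(channel_matrix h n i 1 *v v k) $ r =
            ((h i m $ 1 / h i m $ 2) *s (channel_matrix h n i 2 *v v k)) $ r"
            using nz[of i m] that[of r] by (cases "v k $ r = 0") (simp_all add: channel_matrix_mult_nth)
        qed
      qed
      consider "k = a" | "k = b" | "k = c"
        using three_cases[OF users, of k] by blast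
      then show "\<exists>t. t \<noteq> 0 \<and> channel_matrix h n i 1 *v v k = t *s (channel_matrix h n i 2 *v v k)"
      proof cases
        case 1
        have "h i (n $ r) = h i (n $ 2)" if "v k $ r \<noteq> 0" for r
          using that 1 \<open>k \<noteq> i\<close> three_cases[OF users, of i] exhaust_4[of r] eqs v by auto
        then show ?thesis by (rule *)
      next
        case 2
        have "h i (n $ r) = h i (n $ 3)" if "v k $ r \<noteq> 0" for r
          using that 2 \<open>k \<noteq> i\<close> three_cases[OF users, of i] exhaust_4[of r] eqs v by auto
        then show ?thesis by (rule *)
      next
        case 3
        have "h i (n $ r) = h i (n $ 3)" if "v k $ r \<noteq> 0" for r
          using that 3 \<open>k \<noteq> i\<close> three_cases[OF users, of i] exhaust_4[of r] eqs v by auto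
        then show ?thesis by (rule *)
      qed
    qed
    show "decodable h n v v"
      unfolding decodable_def
    proof (intro allI impI lin_indep_listI4)
      fix i k l :: 3 and \<alpha> \<beta> \<gamma> \<delta> :: complex
      assume d: "distinct [i, k, l]"
        and "\<alpha> *s (channel_matrix h n i 1 *v v i) + \<beta> *s (channel_matrix h n i 2 *v v i) +
          \<gamma> *s (channel_matrix h n i 1 *v v k) + \<delta> *s (channel_matrix h n i 1 *v v l) = 0"
      then have eq: "\<alpha> * (h i (n $ r) $ 1 * v i $ r) + \<beta> * (h i (n $ r) $ 2 * v i $ r) +
          \<gamma> * (h i (n $ r) $ 1 * v k $ r) + \<delta> * (h i (n $ r) $ 1 * v l $ r) = 0" for r
        by (simp add: vec_eq_iff channel_matrix_mult_nth)
      note eq4 = eq[of 1] eq[of 2] eq[of 3] eq[of 4]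
      have kl: "(i = a \<and> k = b \<and> l = c) \<or> (i = a \<and> k = c \<and> l = b) \<or> (i = b \<and> k = a \<and> l = c) \<or>
        (i = b \<and> k = c \<and> l = a) \<or> (i = c \<and> k = a \<and> l = b) \<or> (i = c \<and> k = b \<and> l = a)"
        using d three_cases[OF users, of i] three_cases[OF users, of k] three_cases[OF users, of l]
        by auto
      \<comment> \<open>Outside the support of \<open>v i\<close> only interference is left. Working
        inwards from slots 1 and 4, each interfering vector in turn is the only remaining one in
        some slot, so its coefficient vanishes. The two slots of \<open>v i\<close> then give two
        equations in \<open>\<alpha>\<close> and \<open>\<beta>\<close>.\<close>
      have \<gamma>\<delta>: "\<gamma> = 0 \<and> \<delta> = 0"
        using kl eq4 by (elim disjE) (auto simp: v nz)
      moreover have "\<alpha> = 0 \<and> \<beta> = 0"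
        using kl eq4 \<gamma>\<delta> zero[OF a(1), of \<alpha> \<beta>] zero[OF b(2), of \<alpha> \<beta>] zero[OF c(3), of \<alpha> \<beta>]
        by (elim disjE) (auto simp: v)
      ultimately show "\<alpha> = 0 \<and> \<beta> = 0 \<and> \<gamma> = 0 \<and> \<delta> = 0"
        by simp
    qed
  qed
  then show ?thesis
    unfolding bia_feasible_block_def using less by blast
qed

section \<open>Cutting the segments into pieces and chaining the pieces\<close>

text \<open>Stated for monotone rather than strictly monotone sequences because it serves both for
  the segments and for the pieces inside a segment, and a piece may be empty.\<close>

lemma mono_interval_unique:
  fixes f :: "nat \<Rightarrow> nat"
  assumes "mono f" "f i \<le> n" "n < f (Suc i)" "f j \<le> n" "n < f (Suc j)"
  shows "i = j"
proof (rule ccontr)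
  assume "i \<noteq> j"
  then consider "Suc i \<le> j" | "Suc j \<le> i" by linarith
  then show False
    using assms monoD[OF \<open>mono f\<close>, of "Suc i" j] monoD[OF \<open>mono f\<close>, of "Suc j" i]
    by cases linarith+
qed

lemma interval_exists:
  fixes f :: "nat \<Rightarrow> nat"
  assumes "f 0 \<le> n" "n < f k"
  obtains j where "j < k" "f j \<le> n" "n < f (Suc j)"
  using ex_least_nat_less[of "\<lambda>j. n < f j" k] assms by (auto simp: not_less)

text \<open>Segment \<open>M\<close> is cut into four consecutive pieces, the piece \<open>k\<close>
  having length \<open>x (M - k)\<close> and receiving the slots at position \<open>k\<close> of the
  blocks that started in segment \<open>M - k\<close>. The recurrence \<open>step\<close> says that
  these pieces fill the segment exactly.\<close>

lemma partition_into_chains: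
  fixes T x :: "nat \<Rightarrow> nat"
  assumes "strict_mono T"
    and step: "\<And>M. M \<ge> 3 \<Longrightarrow> T (Suc M) = T M + x M + x (M - 1) + x (M - 2) + x (M - 3)"
  obtains F P where "finite F" "partition_on (UNIV - F) P"
    "\<And>B. B \<in> P \<Longrightarrow> \<exists>m g. B = g ` {..3::nat} \<and> (\<forall>r\<le>3. T (m + r) \<le> g r \<and> g r < T (Suc (m + r)))"
proof -
  \<comment> \<open>\<open>c M k\<close> is where piece \<open>k\<close> of segment \<open>M\<close>
    begins, and \<open>slot m q r\<close> is position \<open>r\<close> of the \<open>q\<close>-th
    block starting in segment \<open>m\<close>. Only blocks with \<open>m \<ge> 3\<close> are used,
    where \<open>step\<close> is available.\<close>
  define c where "c = (\<lambda>M k. T M + (\<Sum>i<k. x (M - i)))"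
  define slot where "slot = (\<lambda>m q r. c (m + r) r + q)"
  define P where "P = (\<lambda>(m, q). slot m q ` {..3}) ` {(m, q). 3 \<le> m \<and> q < x m}"
  have "mono T"
    using \<open>strict_mono T\<close> by (rule strict_mono_mono)
  have "mono (c M)" for M
    by (rule incseq_SucI) (simp add: c_def)
  have c0: "c M 0 = T M" for M
    by (simp add: c_def)
  have c4: "c M 4 = T (Suc M)" if "M \<ge> 3" for M
    using step[OF that] by (simp add: c_def eval_nat_numeral)
  have slot_c: "c (m + r) r \<le> slot m q r \<and> slot m q r < c (m + r) (Suc r)" if "q < x m" for m q r
    using that by (simp add: slot_def c_def)
  have slot_T: "T (m + r) \<le> slot m q r \<and> slot m q r < T (Suc (m + r))"
    if "3 \<le> m" "q < x m" "r \<le> 3" for m q r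
    using slot_c[OF that(2), of r] monoD[OF \<open>mono (c (m + r))\<close>, of "Suc r" 4] c4[of "m + r"]
      monoD[OF \<open>mono (c (m + r))\<close>, of 0 r] c0[of "m + r"] that by force
  have inj: "m = m' \<and> q = q'" if "3 \<le> m" "q < x m" "r \<le> 3" "3 \<le> m'" "q' < x m'" "r' \<le> 3"
    "slot m q r = slot m' q' r'" for m q r m' q' r'
  proof -
    \<comment> \<open>A slot determines its segment, then its piece \<open>r\<close> in that
      segment, and hence the starting segment and the index of its block.\<close>
    have M: "m + r = m' + r'"
      using mono_interval_unique[OF \<open>mono T\<close>] slot_T that by metis
    have "r = r'"
      using mono_interval_unique[OF \<open>mono (c (m + r))\<close>] slot_c[OF that(2), of r]
        slot_c[OF that(5), of r'] that(7) M by metis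
    with M that(7) show ?thesis
      by (simp add: slot_def)
  qed
  \<comment> \<open>Segment 6 is the first one whose four contributing starting segments, 3 to 6,
    are all at least 3.\<close>
  have cover: "n \<in> \<Union> P" if "T 6 \<le> n" for n
  proof -
    have "n < T (Suc n)"
      using strict_mono_imp_increasing[OF \<open>strict_mono T\<close>, of "Suc n"] by linarith
    moreover have "T 0 \<le> n"
      using monoD[OF \<open>mono T\<close>, of 0 6] that by simp
    ultimately obtain M where M: "T M \<le> n" "n < T (Suc M)"
      using interval_exists by metis
    have "6 \<le> M"
      using monoD[OF \<open>mono T\<close>, of "Suc M" 6] M that by linarith
    then obtain k where k: "k < 4" "c M k \<le> n" "n < c M (Suc k)"
      using interval_exists[of "c M" n 4] M c0[of M] c4[of M] by auto
    have "slot (M - k) (n - c M k) k = n" "n - c M k < x (M - k)"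
      using k \<open>6 \<le> M\<close> by (auto simp: slot_def c_def)
    moreover have "3 \<le> M - k" "k \<le> 3"
      using k \<open>6 \<le> M\<close> by auto
    ultimately have "n \<in> slot (M - k) (n - c M k) ` {..3}" "slot (M - k) (n - c M k) ` {..3} \<in> P"
      unfolding P_def by (force, force intro!: image_eqI[of _ _ "(M - k, n - c M k)"])
    then show ?thesis
      by blast
  qed
  \<comment> \<open>The discarded set is defined as whatever the blocks miss, so only its finiteness
    depends on \<open>cover\<close>.\<close>
  have "UNIV - \<Union> P \<subseteq> {..<T 6}"
    using cover by (meson DiffD2 lessThan_iff not_less subsetI)
  then have "finite (UNIV - \<Union> P)"
    using finite_lessThan by (rule finite_subset)
  moreover have "partition_on (UNIV - (UNIV - \<Union> P)) P"
  proof (rule partition_onI)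
    fix A B
    assume "A \<in> P" "B \<in> P" "A \<noteq> B"
    obtain m q m' q' where A: "A = slot m q ` {..3}" "3 \<le> m" "q < x m"
      and B: "B = slot m' q' ` {..3}" "3 \<le> m'" "q' < x m'"
      using \<open>A \<in> P\<close> \<open>B \<in> P\<close> unfolding P_def by auto
    show "disjnt A B"
    proof (rule ccontr)
      assume "\<not> disjnt A B"
      then obtain r r' where "r \<le> 3" "r' \<le> 3" "slot m q r = slot m' q' r'"
        unfolding disjnt_iff A(1) B(1) by auto
      then have "m = m' \<and> q = q'"
        using inj A(2,3) B(2,3) by blast
      then show False
        using \<open>A \<noteq> B\<close> A(1) B(1) by simp
    qed
  qed (auto simp: P_def)
  moreover have "\<exists>m g. B = g ` {..3::nat} \<and> (\<forall>r\<le>3. T (m + r) \<le> g r \<and> g r < T (Suc (m + r)))"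
    if "B \<in> P" for B
  proof -
    obtain m q where "B = slot m q ` {..3}" "3 \<le> m" "q < x m"
      using \<open>B \<in> P\<close> unfolding P_def by auto
    then show ?thesis
      using slot_T by (intro exI[of _ m] exI[of _ "slot m q"]) auto
  qed
  ultimately show ?thesis
    by (rule that)
qed

section \<open>Block counts and the segments given by the offsets\<close>

text \<open>Four consecutive numbers run through all residues modulo 4, so this is Hermite's
  identity for \<open>N / 4\<close>, up to the order of the summands.\<close>

lemma sum_quarters:
  fixes N m :: nat
  shows "(N + m mod 4) div 4 + (N + Suc m mod 4) div 4 + (N + Suc (Suc m) mod 4) div 4
    + (N + Suc (Suc (Suc m)) mod 4) div 4 = N"
proof -
  have small: "k mod 4 = 0 \<or> k mod 4 = 1 \<or> k mod 4 = 2 \<or> k mod 4 = 3" for k :: nat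
    using mod_less_divisor[of 4 k] by force
  define q where "q = N div 4"
  define r where "r = N mod 4"
  have N: "N = r + q * 4"
    by (simp add: q_def r_def)
  have shift: "(N + t) div 4 = q + (r + t) div 4" for t
  proof -
    have "N + t = (r + t) + q * 4"
      using N by simp
    then have "(N + t) div 4 = ((r + t) + q * 4) div 4"
      by (rule arg_cong)
    then show ?thesis
      by (simp only: div_mult_self1)
  qed
  \<comment> \<open>The carry \<open>(r + t) div 4\<close> is 1 for exactly \<open>r\<close> of the
    values \<open>t = 0, 1, 2, 3\<close>, and 0 for the others.\<close>
  have "q + (q + (r + 1) div 4) + (q + (r + 2) div 4) + (q + (r + 3) div 4) = r + q * 4"
    using small[of N] unfolding r_def[symmetric] by auto
  then have "(N + 0) div 4 + (N + 1) div 4 + (N + 2) div 4 + (N + 3) div 4 = N"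
    unfolding shift add_0_right q_def[symmetric] N[symmetric] .
  moreover define g where "g = (\<lambda>k. (N + k) div 4)"
  ultimately have "g 0 + g 1 + g 2 + g 3 = N"
    by simp
  with small[of m] have "g (m mod 4) + g (Suc m mod 4) + g (Suc (Suc m) mod 4)
      + g (Suc (Suc (Suc m)) mod 4) = N"
    by (elim disjE) (simp_all add: mod_Suc numeral_2_eq_2 numeral_3_eq_3)
  then show ?thesis
    unfolding g_def .
qed

theorem theorem1:
  fixes N :: nat and offset :: "3 \<Rightarrow> nat" and s :: "nat \<Rightarrow> nat"
  assumes "N \<ge> 1"
    and "offset 1 = 0" and "offset 2 < N" and "offset 3 < N"
    and "s 0 = min (offset 2) (offset 3)"
    and "s 1 = max (offset 2) (offset 3) - min (offset 2) (offset 3)"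
    and "s 2 = N - max (offset 2) (offset 3)"
    and "(\<Sum>i = 0..2. s i) \<le> 4 * min (s 0) (min (s 1) (s 2))"
  shows "bia_feasible_bc N offset"
proof -
  \<comment> \<open>Users 2 and 3 play symmetric roles, so the users are renamed by increasing
    offset.\<close>
  have sorted: "bia_feasible_bc N offset"
    if users: "distinct [a, b, c]"
      and offs: "offset a = 0" "offset b \<le> offset c" "offset c < N"
      and gaps: "N \<le> 4 * offset b" "N \<le> 4 * (offset c - offset b)" "N \<le> 4 * (N - offset c)"
    for a b c :: 3
  proof -
    \<comment> \<open>\<open>T M\<close> is the start of segment \<open>M\<close>, and
      \<open>U (M mod 3)\<close> is the user whose coherence block begins there.\<close>
    define U where "U = (\<lambda>t::nat. if t = 0 then a else if t = 1 then b else c)"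
    define T where "T = (\<lambda>M. (M div 3) * N + offset (U (M mod 3)))"
    define len where "len = (\<lambda>t::nat. if t = 0 then offset b else if t = 1 then offset c - offset b
                                   else N - offset c)"
    define f where "f = (\<lambda>m. (N + m mod 4) div 4)"
    define \<sigma> where "\<sigma> = (\<lambda>m. len (m mod 3))"
    define x where "x = (\<lambda>m. \<sigma> m - f m)"
    have T_Suc: "T (Suc M) = T M + \<sigma> M" for M
    proof -
      have "M mod 3 = 0 \<or> M mod 3 = 1 \<or> M mod 3 = 2" by linarith
      then show ?thesis
        using offs by (auto simp: T_def len_def \<sigma>_def U_def mod_Suc div_Suc)
    qed
    have gap: "N \<le> 4 * \<sigma> m" for m
      using gaps by (simp add: \<sigma>_def len_def)
    have "0 < \<sigma> m" for m
      using gap[of m] offs by linarith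
    then have "strict_mono T"
      by (simp add: strict_mono_Suc_iff T_Suc)
    have "f m \<le> \<sigma> m" for m
    proof -
      have "m mod 4 \<le> 3"
        by simp
      with gap[of m] have "N + m mod 4 \<le> 4 * \<sigma> m + 3"
        by (rule add_mono)
      then have "N + m mod 4 < 4 * Suc (\<sigma> m)"
        by simp
      then have "f m < Suc (\<sigma> m)"
        unfolding f_def by (simp add: less_mult_imp_div_less mult.commute)
      then show ?thesis
        by simp
    qed
    \<comment> \<open>From here on the truncated subtraction in \<open>x\<close> is exact.\<close>
    then have x: "x m + f m = \<sigma> m" for m
      by (simp add: x_def)
    have step: "T (Suc M) = T M + x M + x (M - 1) + x (M - 2) + x (M - 3)" if "M \<ge> 3" for M
    proof -
      define m where "m = M - 3"
      then have m: "M = Suc (Suc (Suc m))"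
        using that by simp
      have "\<sigma> m + \<sigma> (Suc m) + \<sigma> (Suc (Suc m)) = N"
      proof -
        have "m mod 3 = 0 \<or> m mod 3 = 1 \<or> m mod 3 = 2" by linarith
        then show ?thesis
          using offs by (auto simp: \<sigma>_def len_def mod_Suc)
      qed
      moreover have "x (M - 1) = x (Suc (Suc m))" "x (M - 2) = x (Suc m)" "x (M - 3) = x m"
        by (simp_all add: m)
      moreover have "M mod 3 = m mod 3"
        by (simp add: m flip: add_Suc_right Suc_eq_plus1)
      then have "\<sigma> M = \<sigma> m"
        by (simp add: \<sigma>_def)
      moreover have "f m + f (Suc m) + f (Suc (Suc m)) + f M = N"
        unfolding f_def m by (rule sum_quarters)
      ultimately show ?thesis
        using x[of m] x[of "Suc m"] x[of "Suc (Suc m)"] x[of M] T_Suc[of M] by linarith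
    qed
    \<comment> \<open>User \<open>U t\<close> changes exactly at the starts of the segments
      \<open>t, t + 3, t + 6, ...\<close>, so its block number depends only on the segment.\<close>
    have coh: "coherence_block N offset (U t) n = (int M - int t) div 3"
      if "T M \<le> n" "n < T (Suc M)" "t < 3" for M n t
    proof -
      have block: "coherence_block N offset (U t) n = z"
        if "z * int N \<le> int n - int (offset (U t))" "int n - int (offset (U t)) < (z + 1) * int N" for z
        unfolding coherence_block_def
        using that by (intro int_div_pos_eq[of _ _ _ "int n - int (offset (U t)) - z * int N"])
          (auto simp: algebra_simps)
      have T_eq: "T (3 * k + t) = k * N + offset (U t)" for k
        using \<open>t < 3\<close> by (simp add: T_def)
      note mono = strict_mono_less_eq[OF \<open>strict_mono T\<close>, THEN iffD2]
      show ?thesis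
      proof (cases "t \<le> M")
        case True
        define k where "k = (M - t) div 3"
        define k' where "k' = (M - t) mod 3"
        have M: "M = 3 * k + t + k'"
          using True by (simp add: k_def k'_def)
        have "k' < 3"
          by (simp add: k'_def)
        have "T (3 * k + t) \<le> n"
          using mono[of "3 * k + t" M] M \<open>T M \<le> n\<close> by simp
        moreover have "n < T (3 * (k + 1) + t)"
          using mono[of "Suc M" "3 * (k + 1) + t"] M \<open>k' < 3\<close> \<open>n < T (Suc M)\<close> by simp
        ultimately have "k * N + offset (U t) \<le> n" "n < (k + 1) * N + offset (U t)"
          unfolding T_eq by simp_all
        then have "int (k * N + offset (U t)) \<le> int n" "int n < int ((k + 1) * N + offset (U t))"
          by (simp_all only: of_nat_le_iff of_nat_less_iff)
        then have "coherence_block N offset (U t) n = int k"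
          by (intro block) (simp_all add: algebra_simps)
        moreover have "int k = (int M - int t) div 3"
          using True by (simp add: k_def zdiv_int of_nat_diff)
        ultimately show ?thesis
          by simp
      next
        \<comment> \<open>The slot precedes the first change of this user and lies in the incomplete
          block \<open>-1\<close>; the rounding agrees because
          \<open>-3 < M - t < 0\<close>.\<close>
        case False
        then have "n < offset (U t)"
          using mono[of "Suc M" "3 * 0 + t"] \<open>n < T (Suc M)\<close> unfolding T_eq by simp
        moreover have "offset (U t) < N"
          using offs by (simp add: U_def)
        ultimately have "coherence_block N offset (U t) n = -1"
          by (intro block) simp_all
        moreover have "(int M - int t) div 3 = -1"
          using False \<open>t < 3\<close> by (intro int_div_pos_eq[of _ _ _ "int M - int t + 3"]) simp_all
        ultimately show ?thesis
          by simp
      qed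
    qed
    obtain F P where F: "finite F" "partition_on (UNIV - F) P" and
      P: "\<And>B. B \<in> P \<Longrightarrow> \<exists>m g. B = g ` {..3::nat} \<and> (\<forall>r\<le>3. T (m + r) \<le> g r \<and> g r < T (Suc (m + r)))"
      using partition_into_chains[OF \<open>strict_mono T\<close> step] by metis
    have "\<exists>n. bia_feasible_block N offset n \<and> B = {n $ 1, n $ 2, n $ 3, n $ 4}" if "B \<in> P" for B
    proof -
      obtain m g where g: "B = g ` {..3::nat}" "\<And>r. r \<le> 3 \<Longrightarrow> T (m + r) \<le> g r \<and> g r < T (Suc (m + r))"
        using P[OF \<open>B \<in> P\<close>] by blast
      define n :: "nat ^ 4" where "n = (\<chi> i. if i = 1 then g 0 else if i = 2 then g 1 else if i = 3 then g 2 else g 3)"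
      have n: "n $ 1 = g 0" "n $ 2 = g 1" "n $ 3 = g 2" "n $ 4 = g 3"
        by (simp_all add: n_def)
      have "{..3::nat} = {0, 1, 2, 3}" by auto
      then have B: "B = {n $ 1, n $ 2, n $ 3, n $ 4}"
        by (simp add: g(1) n)
      have less: "n $ 1 < n $ 2" "n $ 2 < n $ 3" "n $ 3 < n $ 4"
        using g(2)[of 0] g(2)[of 1] g(2)[of 2] g(2)[of 3] by (simp_all add: n eval_nat_numeral)
      \<comment> \<open>For \<open>k = 1, 2, 3\<close> and \<open>r \<le> 3\<close> the last summand
        is \<open>-1\<close> if \<open>r < k\<close> and \<open>0\<close> otherwise. Hence the user
        with parameter \<open>k\<close> changes between \<open>g (k - 1)\<close> and
        \<open>g k\<close> and nowhere else in the block.\<close>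
      have K: "coherence_block N offset (U ((m + k) mod 3)) (g r) =
          int ((m + k) div 3) + (int r - int k) div 3" if "r \<le> 3" for r k
      proof -
        have "coherence_block N offset (U ((m + k) mod 3)) (g r) =
          (int (m + r) - int ((m + k) mod 3)) div 3"
          using coh[of "m + r" "g r" "(m + k) mod 3"] g(2)[OF that] by simp
        also have "int (m + r) - int ((m + k) mod 3) = (int r - int k) + int ((m + k) div 3) * 3"
          using div_mult_mod_eq[of "m + k" 3] by linarith
        finally show ?thesis
          by simp
      qed
      have "bia_feasible_block N offset n"
      proof (rule bia_feasible_block_chain[OF _ less _ _ _ _ _ _ _ _ _ refl])
        show "distinct [U ((m + 1) mod 3), U ((m + 2) mod 3), U ((m + 3) mod 3)]"
        proof -
          have "m mod 3 = 0 \<or> m mod 3 = 1 \<or> m mod 3 = 2" by linarith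
          then show ?thesis
            using users by (auto simp: U_def mod_Suc)
        qed
      qed (simp_all only: n K, simp_all)
      with B show ?thesis by blast
    qed
    with F show ?thesis
      unfolding bia_feasible_bc_def by blast
  qed
  have "(\<Sum>i = 0..2. s i) = s 0 + s 1 + s 2"
    by (simp add: eval_nat_numeral)
  then have "s 0 + s 1 + s 2 \<le> 4 * min (s 0) (min (s 1) (s 2))"
    using assms(8) by simp
  \<comment> \<open>The gaps add up to \<open>N\<close>, so the hypothesis says that each of them is
    at least a quarter of \<open>N\<close>.\<close>
  moreover have "s 0 + s 1 + s 2 = N"
    unfolding assms(5-7) using assms(3,4) by linarith
  ultimately have gaps: "N \<le> 4 * s 0" "N \<le> 4 * s 1" "N \<le> 4 * s 2"
    by simp_all
  show ?thesis
  proof (cases "offset 2 \<le> offset 3")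
    case True
    then have "s 0 = offset 2" "s 1 = offset 3 - offset 2" "s 2 = N - offset 3"
      by (simp_all add: assms(5-7) del: One_nat_def)
    with gaps True assms(2,4) show ?thesis
      by (intro sorted[of 1 2 3]) (simp_all del: One_nat_def)
  next
    case False
    then have "s 0 = offset 3" "s 1 = offset 2 - offset 3" "s 2 = N - offset 2"
      by (simp_all add: assms(5-7) del: One_nat_def)
    with gaps False assms(2,3) show ?thesis
      by (intro sorted[of 1 3 2]) (simp_all del: One_nat_def)
  qed
qed

end
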